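(* For integers $m,\ell,n\ge 0$ let $$g^m_{\ell,n}=\int_{-1}^{1}\frac{\mathrm{P}_\ell^m(x)\,\mathrm{P}_n^m(x)}{\sqrt{1-x^2}}\,\mathrm{d}x,$$ where $\mathrm{P}_n^m$ denotes the Legendre function on $(-1,1)$ of degree $n$ and order $m$. Then for all integers $m,n,\ell\ge 0$ with $m\le\min\{\ell,n\}$, $$\frac{n-m+1}{2n+1}\,g^m_{n+1,\ell}+\frac{m+n}{2n+1}\,g^m_{n-1,\ell}=\frac{\ell-m+1}{2\ell+1}\,g^m_{n,\ell+1}+\frac{m+\ell}{2\ell+1}\,g^m_{n,\ell-1}.$$
   Context: For integers $n,m\ge 0$ the Legendre functions are normalised by $$\mathrm{P}_n^m(x)=\frac{(-n)_m(1+n)_m}{m!}\left(\frac{1-x}{1+x}\right)^{m/2}{}_2F_1\!\left(-n,\,n+1;\,m+1;\,\frac{1-x}{2}\right),\qquad x\in(-1,1),$$ where $(z)_k=z(z+1)\cdots(z+k-1)$ is the Pochhammer symbol (with $(z)_0=1$) and ${}_2F_1$ is the Gauss hypergeometric function (here a terminating sum). Thus $\mathrm{P}_n^0=\mathrm{P}_n$ is the standard Legendre polynomial, $\mathrm{P}_n^1(x)=-\sqrt{1-x^2}\,\mathrm{P}_n'(x)$, and $\mathrm{P}_n^m\equiv 0$ if $0\le n<m$. Terms with an index $-1$ (which arise only for $m=0$ and $n=0$ or $\ell=0$, with coefficient zero) are read as $0$. *)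

theory Defs
  imports "HOL-Analysis.Analysis"
begin

definition hypergeo_2F1 :: "real \<Rightarrow> real \<Rightarrow> real \<Rightarrow> real \<Rightarrow> real" where
  "hypergeo_2F1 a b c z = eval_fps (fps_hypergeo [a, b] [c] 1) z"

lemma hypergeo_2F1_altdef:
  "hypergeo_2F1 a b c z =
     (\<Sum>k. pochhammer a k * pochhammer b k / (pochhammer c k * fact k) * z ^ k)"
  by (simp add: hypergeo_2F1_def eval_fps_def)

(* Legendre function of degree n and order m, meaningful for -1 < x < 1. *)
definition legendre_P :: "nat \<Rightarrow> nat \<Rightarrow> real \<Rightarrow> real" where
  "legendre_P m n x =
     pochhammer (- real n) m * pochhammer (1 + real n) m / fact m
       * ((1 - x) / (1 + x)) powr (real m / 2)
       * hypergeo_2F1 (- real n) (real n + 1) (real m + 1) ((1 - x) / 2)"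

(* The order m comes first; legendre_g m l n is the entry with upper index m and
   lower indices l, n. *)
definition legendre_g :: "nat \<Rightarrow> nat \<Rightarrow> nat \<Rightarrow> real" where
  "legendre_g m l n =
     (LBINT x:{-1<..<1}. legendre_P m l x * legendre_P m n x / sqrt (1 - x\<^sup>2))"

end

theory Submission
  imports Defs
begin

text \<open>
  Both sides equal the integral of \<open>x P\<^sub>n\<^sup>m(x) P\<^sub>l\<^sup>m(x) / sqrt (1 - x\<^sup>2)\<close>, by the
  three-term recurrence for \<open>P\<^sup>m\<close> applied to either factor. The recurrence comes from a contiguous
  relation for \<open>2F1(-n, n+1; m+1; z)\<close>. Integrability at \<open>x = -1\<close> is not visible from the
  normalisation; it holds because for \<open>n \<ge> m\<close> the terminating hypergeometric sum is divisible by
  \<open>(1 - z)^m\<close>, which follows from the same contiguous relation by induction on \<open>n\<close>.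
\<close>

section \<open>Contiguous relation for the hypergeometric factor\<close>

text \<open>The degree \<open>a\<close> is real, so \<open>a - 1\<close> and \<open>a + 1\<close>
  are true shifts, without truncated subtraction.\<close>

definition legendre_coeff :: "real \<Rightarrow> real \<Rightarrow> nat \<Rightarrow> real" where
  "legendre_coeff m a k =
     pochhammer (- a) k * pochhammer (a + 1) k / (pochhammer (m + 1) k * fact k)"

lemma hypergeo_legendre:
  "hypergeo_2F1 (- a) (a + 1) (m + 1) z = (\<Sum>k. legendre_coeff m a k * z ^ k)"
  by (simp add: hypergeo_2F1_altdef legendre_coeff_def)

text \<open>The factor \<open>a + 1\<close> split off from the first product completes the second to
  \<open>pochhammer (a + 1) (k + 2)\<close>, so nothing is divided by and \<open>a\<close> stays
  arbitrary.\<close>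

lemma pochhammer_raise:
  fixes a :: real
  shows "pochhammer (- (a + 1)) (Suc k) * pochhammer (a + 2) (Suc k)
       = - (pochhammer (- a) k * pochhammer (a + 1) k * (a + k + 1) * (a + k + 2))"
proof -
  have 1: "pochhammer (- (a + 1)) (Suc k) = - (a + 1) * pochhammer (- a) k"
    by (simp add: pochhammer_rec)
  have "(a + 1) * pochhammer (a + 2) (Suc k) = pochhammer (a + 1) (Suc (Suc k))"
    by (simp add: pochhammer_rec[of "a + 1"] add.assoc)
  also have "\<dots> = pochhammer (a + 1) k * (a + k + 1) * (a + k + 2)"
    by (simp add: pochhammer_Suc algebra_simps)
  finally show ?thesis
    unfolding 1 by algebra
qed

text \<open>The mirror image of \<open>pochhammer_raise\<close> under \<open>a\<close> to
  \<open>- 1 - a\<close>, which swaps the two upper parameters.\<close>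

lemma pochhammer_lower:
  fixes a :: real
  shows "pochhammer (- (a - 1)) (Suc k) * pochhammer a (Suc k)
       = - (pochhammer (- a) k * pochhammer (a + 1) k * (k - a) * (k - a + 1))"
proof -
  have 1: "pochhammer a (Suc k) = a * pochhammer (a + 1) k"
    by (simp add: pochhammer_rec)
  have "- a * pochhammer (- (a - 1)) (Suc k) = pochhammer (- a) (Suc (Suc k))"
    by (simp add: pochhammer_rec[of "- a"] add.commute)
  also have "\<dots> = pochhammer (- a) k * (k - a) * (k - a + 1)"
    by (simp add: pochhammer_Suc algebra_simps)
  finally show ?thesis
    unfolding 1 by algebra
qed

text \<open>Over the common denominator \<open>D * E\<close> every coefficient is \<open>B\<close>
  times a polynomial in \<open>a\<close>, \<open>m\<close> and \<open>k\<close>, which leaves a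
  polynomial identity. The index drops to \<open>k\<close> in the last term because that term will
  carry the extra factor \<open>z\<close>.\<close>

lemma legendre_coeff_contiguous:
  assumes "m \<ge> 0"
  shows "(a + m + 1) * legendre_coeff m (a + 1) (Suc k)
           + (a - m) * legendre_coeff m (a - 1) (Suc k)
       = (2 * a + 1) * (legendre_coeff m a (Suc k) - 2 * legendre_coeff m a k)"
proof -
  define B where "B = pochhammer (- a) k * pochhammer (a + 1) k"
  define D where "D = pochhammer (m + 1) k * (fact k :: real)"
  define E where "E = (m + 1 + k) * (real k + 1)"
  have E: "E > 0" using assms by (auto simp: E_def intro!: mult_pos_pos)
  have den: "pochhammer (m + 1) (Suc k) * fact (Suc k) = D * E"
    by (simp add: D_def E_def pochhammer_Suc algebra_simps)
  have up: "legendre_coeff m (a + 1) (Suc k) = - (B * (a + k + 1) * (a + k + 2)) / (D * E)"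
    using pochhammer_raise[of a k] den by (simp add: legendre_coeff_def B_def add.assoc)
  have down: "legendre_coeff m (a - 1) (Suc k) = - (B * (k - a) * (k - a + 1)) / (D * E)"
    using pochhammer_lower[of a k] den by (simp add: legendre_coeff_def B_def)
  have mid: "legendre_coeff m a (Suc k) = B * (k - a) * (a + k + 1) / (D * E)"
    unfolding legendre_coeff_def den by (simp add: pochhammer_Suc B_def algebra_simps)
  have here: "legendre_coeff m a k = B * E / (D * E)"
    using E by (simp add: legendre_coeff_def B_def D_def)
  have "(a + m + 1) * (- (B * (a + k + 1) * (a + k + 2)))
        + (a - m) * (- (B * (k - a) * (k - a + 1)))
      = (2 * a + 1) * (B * (k - a) * (a + k + 1) - 2 * (B * E))"
    unfolding E_def by algebra
  then show ?thesis
    unfolding up down mid here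
    by (simp only: times_divide_eq_right add_divide_distrib[symmetric] diff_divide_distrib[symmetric])
qed

lemma legendre_coeff_0 [simp]: "legendre_coeff m a 0 = 1"
  by (simp add: legendre_coeff_def)

lemma legendre_coeff_eq_0: "k > n \<Longrightarrow> legendre_coeff m (real n) k = 0"
  by (simp add: legendre_coeff_def pochhammer_of_nat_eq_0_iff)

lemma summable_legendre: "summable (\<lambda>k. legendre_coeff m (real n) k * z ^ k)"
  by (rule summable_finite[of "{..n}"]) (auto simp: legendre_coeff_eq_0)

text \<open>Sum the coefficient relation against \<open>z ^ Suc k\<close>; the constant terms agree
  since (n + m + 1) + (n - m) = 2 n + 1. For \<open>n = 0\<close> the index \<open>n - 1\<close>
  truncates to 0, and the second assumption makes its coefficient \<open>n - m\<close>
  vanish.\<close>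

lemma hypergeo_contiguous:
  fixes n :: nat and m z :: real
  assumes "m \<ge> 0" "n = 0 \<Longrightarrow> m = 0"
  defines "F \<equiv> \<lambda>(n::nat) z::real. hypergeo_2F1 (- real n) (real n + 1) (m + 1) z"
  shows "(n + m + 1) * F (n + 1) z + (n - m) * F (n - 1) z = (2 * n + 1) * (1 - 2 * z) * F n z"
proof -
  define t where "t = (\<lambda>n k. legendre_coeff m (real n) k)"
  have F: "F n z = (\<Sum>k. t n k * z ^ k)" for n
    by (simp add: F_def hypergeo_legendre t_def)
  have s: "summable (\<lambda>k. t n k * z ^ k)" for n
    by (simp add: t_def summable_legendre)
  have s1: "(\<lambda>k. t n (Suc k) * z ^ Suc k) sums (F n z - 1)" for n
  proof -
    have "(\<lambda>k. t n k * z ^ k) sums F n z" using s F by (simp add: summable_sums)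
    from sums_split_initial_segment[OF this, of 1] show ?thesis
      by (simp add: t_def)
  qed
  have c: "(n + m + 1) * t (n + 1) (Suc k) + (n - m) * t (n - 1) (Suc k)
      = (2 * n + 1) * (t n (Suc k) - 2 * t n k)" for k
  proof (cases "n = 0")
    case False
    then show ?thesis
      using legendre_coeff_contiguous[of m "real n" k] assms by (simp add: t_def of_nat_diff add.commute)
  next
    case True
    then show ?thesis
      using legendre_coeff_contiguous[of m "real n" k] assms by (simp add: t_def)
  qed
  have "(\<lambda>k. (n + m + 1) * (t (n + 1) (Suc k) * z ^ Suc k)
          + (n - m) * (t (n - 1) (Suc k) * z ^ Suc k))
        sums ((n + m + 1) * (F (n + 1) z - 1) + (n - m) * (F (n - 1) z - 1))"
    by (intro sums_add sums_mult s1)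
  also have "(\<lambda>k. (n + m + 1) * (t (n + 1) (Suc k) * z ^ Suc k)
          + (n - m) * (t (n - 1) (Suc k) * z ^ Suc k))
      = (\<lambda>k. (2 * n + 1) * (t n (Suc k) * z ^ Suc k) - (2 * n + 1) * (2 * z) * (t n k * z ^ k))"
  proof
    fix k
    show "(n + m + 1) * (t (n + 1) (Suc k) * z ^ Suc k)
          + (n - m) * (t (n - 1) (Suc k) * z ^ Suc k)
      = (2 * n + 1) * (t n (Suc k) * z ^ Suc k) - (2 * n + 1) * (2 * z) * (t n k * z ^ k)"
      using arg_cong[OF c[of k], of "\<lambda>u. u * z ^ Suc k"] by (simp add: algebra_simps)
  qed
  finally have l: "\<dots> sums ((n + m + 1) * (F (n + 1) z - 1) + (n - m) * (F (n - 1) z - 1))" .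
  have r: "(\<lambda>k. (2 * n + 1) * (t n (Suc k) * z ^ Suc k) - (2 * n + 1) * (2 * z) * (t n k * z ^ k))
      sums ((2 * n + 1) * (F n z - 1) - (2 * n + 1) * (2 * z) * F n z)"
    using s[of n] by (intro sums_diff sums_mult s1) (simp add: F summable_sums)
  from sums_unique2[OF l r] show ?thesis by (simp add: algebra_simps)
qed

section \<open>Divisibility by the power of 1 - z and behaviour at x = -1\<close>

text \<open>The upper parameter \<open>m + 1\<close> cancels the lower one, leaving the binomial
  series. This is the base case of \<open>hypergeo_factor\<close>.\<close>

lemma hypergeo_diagonal:
  "hypergeo_2F1 (- real m) (real m + 1) (real m + 1) z = (1 - z) ^ m"
proof -
  have "legendre_coeff (real m) (real m) k = (-1) ^ k * real (m choose k)" for k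
  proof -
    have "pochhammer (real m + 1) k > 0" by (rule pochhammer_pos) simp
    moreover have "real (m choose k) = (-1) ^ k * pochhammer (- real m) k / fact k"
      using gbinomial_pochhammer[of "real m" k] by (simp add: binomial_gbinomial)
    ultimately show ?thesis
      by (simp add: legendre_coeff_def flip: power_add mult_2)
  qed
  then have "hypergeo_2F1 (- real m) (real m + 1) (real m + 1) z
      = (\<Sum>k. (-1) ^ k * real (m choose k) * z ^ k)"
    by (simp add: hypergeo_legendre)
  also have "\<dots> = (\<Sum>k\<le>m. (-1) ^ k * real (m choose k) * z ^ k)"
    by (rule suminf_finite) auto
  also have "\<dots> = (- z + 1) ^ m"
    by (subst binomial_ring) (auto intro!: sum.cong simp: power_minus[of z])
  finally show ?thesis by simp
qed

text \<open>Solve the contiguous relation at degree \<open>m + j\<close> for the term of degree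
  \<open>m + j + 1\<close>: its coefficient \<open>2 * m + j + 1\<close> is positive, and the two
  lower terms are divisible by induction. Continuity of the quotient is all that integrability
  needs.\<close>

lemma hypergeo_factor:
  fixes m i :: nat
  shows "\<exists>q. continuous_on UNIV q \<and>
    (\<forall>z. hypergeo_2F1 (- real (m + i)) (real (m + i) + 1) (real m + 1) z = (1 - z) ^ m * q z)"
proof (induction i rule: less_induct)
  case (less i)
  define F where "F = (\<lambda>n z. hypergeo_2F1 (- real n) (real n + 1) (real m + 1) z)"
  show ?case
  proof (cases i)
    case 0
    then show ?thesis
      by (intro exI[of _ "\<lambda>_. 1"]) (simp add: hypergeo_diagonal)
  next
    case (Suc j)
    obtain q where q: "continuous_on UNIV q" "\<And>z. F (m + j) z = (1 - z) ^ m * q z"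
      using less[of j] Suc by (auto simp: F_def)
    \<comment> \<open>The factor \<open>j\<close> is kept with the lower term: at
      \<open>j = 0\<close> it removes the degree below \<open>m\<close>, about which the induction
      says nothing.\<close>
    obtain p where p: "continuous_on UNIV p"
      "\<And>z. real j * F (m + j - 1) z = (1 - z) ^ m * p z"
    proof (cases j)
      case 0
      then show ?thesis using that[of "\<lambda>_. 0"] by simp
    next
      case (Suc j')
      then obtain p' where p': "continuous_on UNIV p'" "\<And>z. F (m + j') z = (1 - z) ^ m * p' z"
        using less[of j'] \<open>i = Suc j\<close> by (auto simp: F_def)
      show ?thesis
        using p' Suc by (intro that[of "\<lambda>z. real j * p' z"]) (auto intro!: continuous_intros)
    qed
    define r where "r = (\<lambda>z. ((2 * real (m + j) + 1) * (1 - 2 * z) * q z - p z) / (2 * m + j + 1))"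
    have "continuous_on UNIV r"
      unfolding r_def using p q by (intro continuous_intros) auto
    moreover have "F (m + i) z = (1 - z) ^ m * r z" for z
    proof -
      have "(2 * m + j + 1) * F (m + i) z + j * F (m + j - 1) z
          = (2 * real (m + j) + 1) * (1 - 2 * z) * F (m + j) z"
        using hypergeo_contiguous[of "real m" "m + j" z] Suc
        by (simp add: F_def algebra_simps)
      then have "(2 * m + j + 1) * F (m + i) z
          = (1 - z) ^ m * ((2 * real (m + j) + 1) * (1 - 2 * z) * q z - p z)"
        unfolding p q by (simp add: algebra_simps)
      moreover have "2 * real m + j + 1 \<noteq> 0" by linarith
      ultimately show ?thesis by (simp add: r_def field_simps)
    qed
    ultimately show ?thesis unfolding F_def by blast
  qed
qed

text \<open>With z = (1 - x) / 2 one has 1 - z = (1 + x) / 2, so the factor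
  \<open>(1 - z) ^ m\<close> cancels the singularity of the power of (1 - x) / (1 + x) at x = -1 and
  turns it into a power of \<open>sqrt (1 - x\<^sup>2)\<close>. For \<open>n < m\<close> the
  prefactor \<open>pochhammer (- real n) m\<close> is zero.\<close>

lemma legendre_P_factor:
  "\<exists>q. continuous_on UNIV q \<and>
     (\<forall>x\<in>{-1<..<1}. legendre_P m n x = sqrt (1 - x\<^sup>2) ^ m * q x)"
proof (cases "n < m")
  case True
  then show ?thesis
    by (intro exI[of _ "\<lambda>_. 0"]) (simp add: legendre_P_def pochhammer_of_nat_eq_0_iff)
next
  case False
  then obtain q where q: "continuous_on UNIV q"
    "\<And>z. hypergeo_2F1 (- real n) (real n + 1) (real m + 1) z = (1 - z) ^ m * q z"
    using hypergeo_factor[of m "n - m"] by auto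
  define C where "C = pochhammer (- real n) m * pochhammer (1 + real n) m / fact m"
  have "continuous_on UNIV (\<lambda>x::real. C / 2 ^ m * q ((1 - x) / 2))"
    by (intro continuous_intros continuous_on_compose2[OF q(1)]) auto
  moreover have "legendre_P m n x = sqrt (1 - x\<^sup>2) ^ m * (C / 2 ^ m * q ((1 - x) / 2))"
    if x: "x \<in> {-1<..<1}" for x
  proof -
    have pos: "1 - x > 0" "1 + x > 0" using x by auto
    have "((1 - x) / (1 + x)) powr (real m / 2) = sqrt ((1 - x) / (1 + x)) ^ m"
      using pos by (simp add: powr_half_sqrt[symmetric] powr_powr flip: powr_realpow)
    moreover have "sqrt ((1 - x) / (1 + x)) * (1 + x) = sqrt (1 - x\<^sup>2)"
    proof -
      have "sqrt ((1 - x) / (1 + x)) * (1 + x) = sqrt ((1 - x) / (1 + x)) * sqrt ((1 + x)\<^sup>2)"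
        using pos by simp
      also have "\<dots> = sqrt (1 - x\<^sup>2)"
        unfolding real_sqrt_mult[symmetric] using pos
        by (simp add: power2_eq_square field_simps)
      finally show ?thesis .
    qed
    moreover have "1 - (1 - x) / 2 = (1 + x) / 2" by (simp add: field_simps)
    ultimately have "((1 - x) / (1 + x)) powr (real m / 2) * (1 - (1 - x) / 2) ^ m
        = sqrt (1 - x\<^sup>2) ^ m / 2 ^ m"
      by (simp only: power_divide times_divide_eq_right flip: power_mult_distrib)
    from arg_cong[OF this, of "\<lambda>u. C * u * q ((1 - x) / 2)"] show ?thesis
      unfolding legendre_P_def q(2) C_def[symmetric]
      by (simp only: times_divide_eq_left times_divide_eq_right mult_ac)
  qed
  ultimately show ?thesis by blast
qed

section \<open>Three-term recurrence in the degree\<close>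

text \<open>This is \<open>hypergeo_contiguous\<close> at z = (1 - x) / 2, where 1 - 2 z = x. The
  ratio of consecutive prefactors \<open>A\<close> exchanges the coefficients n - m + 1 and n + m
  for n + m + 1 and n - m.\<close>

lemma legendre_P_recurrence:
  assumes "m \<le> n" "x \<in> {-1<..<1}"
  shows "(real n - real m + 1) * legendre_P m (n + 1) x
       + (real m + real n) * (if n = 0 then 0 else legendre_P m (n - 1) x)
     = (2 * real n + 1) * (x * legendre_P m n x)"
proof -
  define A where "A = (\<lambda>n. pochhammer (- real n) m * pochhammer (1 + real n) m / fact m)"
  define w where "w = ((1 - x) / (1 + x)) powr (real m / 2)"
  define F where "F = (\<lambda>n. hypergeo_2F1 (- real n) (real n + 1) (real m + 1) ((1 - x) / 2))"
  have P: "legendre_P m n x = A n * w * F n" for n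
    by (simp add: legendre_P_def A_def w_def F_def)
  have A: "(real n + 1 - real m) * A (Suc n) = (real n + 1 + m) * A n" for n
  proof -
    have 1: "(real n + 1 - m) * pochhammer (- real (Suc n)) m = (real n + 1) * pochhammer (- real n) m"
      using pochhammer_rec[of "- real (Suc n)" m] pochhammer_Suc[of "- real (Suc n)" m]
      by (simp add: algebra_simps)
    have 2: "(real n + 1) * pochhammer (1 + real (Suc n)) m = (real n + 1 + m) * pochhammer (1 + real n) m"
      using pochhammer_rec[of "1 + real n" m] pochhammer_Suc[of "1 + real n" m]
      by (simp add: algebra_simps)
    \<comment> \<open>The extra factor \<open>real n + 1\<close> lets both Pochhammer shifts be used
      without division; being nonzero, it is cancelled at the end.\<close>
    have "(real n + 1) * ((real n + 1 - m) * A (Suc n)) =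
        ((real n + 1 - m) * pochhammer (- real (Suc n)) m)
          * ((real n + 1) * pochhammer (1 + real (Suc n)) m) / fact m"
      by (simp add: A_def)
    also have "\<dots> = (real n + 1) * ((real n + 1 + m) * A n)"
      unfolding 1 2 by (simp add: A_def)
    finally show ?thesis by (subst (asm) mult_cancel_left) auto
  qed
  have up: "(real n - real m + 1) * A (n + 1) = (n + m + 1) * A n"
    using A[of n] by (simp add: algebra_simps)
  \<comment> \<open>For \<open>n = 0\<close> the assumption \<open>m \<le> n\<close> gives
    \<open>m = 0\<close>, so both coefficients vanish; otherwise this is \<open>A\<close> one degree
    lower.\<close>
  have down: "(real m + real n) * (if n = 0 then 0 else A (n - 1) * w * F (n - 1))
      = (real n - m) * A n * w * F (n - 1)"
  proof (cases n)
    case 0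
    then show ?thesis using assms by simp
  next
    case (Suc n')
    then show ?thesis using A[of n'] by (simp add: algebra_simps)
  qed
  have "(real n - real m + 1) * legendre_P m (n + 1) x
       + (real m + real n) * (if n = 0 then 0 else legendre_P m (n - 1) x)
     = A n * w * ((n + m + 1) * F (n + 1) + (real n - m) * F (n - 1))"
    unfolding P using down arg_cong[OF up, of "\<lambda>u. u * (w * F (n + 1))"]
    by (simp add: algebra_simps)
  also have "(n + m + 1) * F (n + 1) + (real n - m) * F (n - 1) = (2 * real n + 1) * x * F n"
  proof -
    have "1 - 2 * ((1 - x) / 2) = x" by (simp add: field_simps)
    then show ?thesis
      using hypergeo_contiguous[of "real m" n "(1 - x) / 2"] assms by (simp add: F_def add_ac)
  qed
  finally show ?thesis by (simp add: P)
qed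

section \<open>Integrability against the Chebyshev weight\<close>

text \<open>The weight is nonnegative with antiderivative \<open>arcsin\<close>, whose limits at
  both endpoints are finite.\<close>

lemma set_integrable_inverse_sqrt: "set_integrable lborel {-1<..<1} (\<lambda>x::real. 1 / sqrt (1 - x\<^sup>2))"
proof -
  have *: "set_integrable lborel (einterval (ereal (-1)) (ereal 1)) (\<lambda>x::real. 1 / sqrt (1 - x\<^sup>2))"
  proof (rule interval_integral_FTC_nonneg(1))
    show "ereal (-1) < ereal 1" by simp
    show "DERIV arcsin x :> 1 / sqrt (1 - x\<^sup>2)" if "ereal (-1) < ereal x" "ereal x < ereal 1" for x
      using DERIV_arcsin[of x] that by (simp add: field_simps)
    show "isCont (\<lambda>x. 1 / sqrt (1 - x\<^sup>2)) x" if "ereal (-1) < ereal x" "ereal x < ereal 1" for x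
    proof -
      have "x\<^sup>2 < 1" using that by (simp add: abs_square_less_1 abs_less_iff)
      then show ?thesis by (intro continuous_intros) auto
    qed
    show "AE x in lborel. ereal (-1) < ereal x \<longrightarrow> ereal x < ereal 1 \<longrightarrow> 0 \<le> 1 / sqrt (1 - x\<^sup>2)"
      by (intro AE_I2) (auto simp: abs_square_le_1 abs_le_iff)
    have c: "continuous_on {-1..1} arcsin" by (rule continuous_on_arcsin')
    have "(arcsin \<longlongrightarrow> arcsin (-1)) (at_right (-1))" "(arcsin \<longlongrightarrow> arcsin 1) (at_left 1)"
      using c by (auto intro: continuous_on_Icc_at_rightD continuous_on_Icc_at_leftD
          simp del: arcsin_minus_1 arcsin_1)
    then show "((arcsin \<circ> real_of_ereal) \<longlongrightarrow> arcsin (-1)) (at_right (ereal (-1)))"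
      "((arcsin \<circ> real_of_ereal) \<longlongrightarrow> arcsin 1) (at_left (ereal 1))"
      by (simp_all only: ereal_tendsto_simps1)
  qed
  then show ?thesis by simp
qed

text \<open>By compactness \<open>f\<close> is bounded on the closed interval, so a multiple of the
  weight dominates.\<close>

lemma set_integrable_chebyshev_weight:
  fixes f :: "real \<Rightarrow> real"
  assumes "continuous_on UNIV f"
  shows "set_integrable lborel {-1<..<1} (\<lambda>x. f x / sqrt (1 - x\<^sup>2))"
proof -
  have "compact (f ` {-1..1})"
    using assms by (intro compact_continuous_image) (auto intro: continuous_on_subset)
  then obtain B where B: "\<And>x. x \<in> {-1..1} \<Longrightarrow> \<bar>f x\<bar> \<le> B"
    by (fastforce dest!: compact_imp_bounded simp: bounded_iff)
  have m: "f \<in> borel_measurable borel" using assms by (rule borel_measurable_continuous_onI)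
  show ?thesis
  proof (rule set_integrable_bound)
    show "set_integrable lborel {-1<..<1} (\<lambda>x. B * (1 / sqrt (1 - x\<^sup>2)))"
      by (intro set_integrable_mult_right set_integrable_inverse_sqrt)
    show "set_borel_measurable lborel {-1<..<1} (\<lambda>x. f x / sqrt (1 - x\<^sup>2))"
      unfolding set_borel_measurable_def using m by measurable
    show "AE x in lborel. x \<in> {-1<..<1} \<longrightarrow>
        norm (f x / sqrt (1 - x\<^sup>2)) \<le> norm (B * (1 / sqrt (1 - x\<^sup>2)))"
    proof (intro AE_I2 impI)
      fix x :: real assume "x \<in> {-1<..<1}"
      then have "\<bar>f x\<bar> \<le> \<bar>B\<bar>" using B[of x] by force
      then show "norm (f x / sqrt (1 - x\<^sup>2)) \<le> norm (B * (1 / sqrt (1 - x\<^sup>2)))"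
        by (simp add: abs_mult divide_right_mono)
    qed
  qed
qed

text \<open>By \<open>legendre_P_factor\<close> the numerator agrees on the open interval with a
  function continuous on the whole line.\<close>

lemma set_integrable_legendre:
  "set_integrable lborel {-1<..<1} (\<lambda>x. legendre_P m l x * legendre_P m n x / sqrt (1 - x\<^sup>2))"
proof -
  obtain p q where pq: "continuous_on UNIV p" "continuous_on UNIV q"
    "\<forall>x\<in>{-1<..<1}. legendre_P m l x = sqrt (1 - x\<^sup>2) ^ m * p x"
    "\<forall>x\<in>{-1<..<1}. legendre_P m n x = sqrt (1 - x\<^sup>2) ^ m * q x"
    using legendre_P_factor[of m l] legendre_P_factor[of m n] by blast
  have "set_integrable lborel {-1<..<1}
     (\<lambda>x. ((sqrt (1 - x\<^sup>2) ^ m * p x) * (sqrt (1 - x\<^sup>2) ^ m * q x)) / sqrt (1 - x\<^sup>2))"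
    using pq by (intro set_integrable_chebyshev_weight continuous_intros) auto
  then show ?thesis
    by (rule set_integrable_cong[THEN iffD1, rotated -1]) (use pq in auto)
qed

section \<open>Recurrence for the integrals\<close>

lemma legendre_g_commute: "legendre_g m l n = legendre_g m n l"
  by (simp add: legendre_g_def mult.commute)

text \<open>Apply the three-term recurrence to the factor of degree \<open>n\<close> under the
  integral. The point is that the right-hand side is symmetric in \<open>n\<close> and
  \<open>l\<close>.\<close>

lemma legendre_g_recurrence:
  assumes "m \<le> n"
  shows "(real n - real m + 1) / (2 * real n + 1) * legendre_g m (n + 1) l
       + (real m + real n) / (2 * real n + 1) * (if n = 0 then 0 else legendre_g m (n - 1) l)
     = (LBINT x:{-1<..<1}. x * legendre_P m n x * legendre_P m l x / sqrt (1 - x\<^sup>2))"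
proof -
  define a where "a = (real n - real m + 1) / (2 * real n + 1)"
  \<comment> \<open>The convention for \<open>n = 0\<close> moves into the coefficient, so that
    \<open>h (n - 1)\<close> is always an integrable function.\<close>
  define b where "b = (if n = 0 then 0 else (real m + real n) / (2 * real n + 1))"
  define h where "h = (\<lambda>k x. legendre_P m k x * legendre_P m l x / sqrt (1 - x\<^sup>2))"
  have int: "set_integrable lborel {-1<..<1} (h k)" for k
    unfolding h_def by (rule set_integrable_legendre)
  have g: "legendre_g m k l = (LBINT x:{-1<..<1}. h k x)" for k
    by (simp add: legendre_g_def h_def)
  have "a * legendre_g m (n + 1) l + b * legendre_g m (n - 1) l
      = (LBINT x:{-1<..<1}. a * h (n + 1) x + b * h (n - 1) x)"
    using int by (simp add: set_integral_add g)
  also have "\<dots> = (LBINT x:{-1<..<1}. x * legendre_P m n x * legendre_P m l x / sqrt (1 - x\<^sup>2))"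
  proof (rule set_lebesgue_integral_cong; (intro allI impI)?)
    fix x :: real assume "x \<in> {-1<..<1}"
    have "2 * real n + 1 \<noteq> 0" by linarith
    then have "a * legendre_P m (n + 1) x + b * legendre_P m (n - 1) x = x * legendre_P m n x"
      using arg_cong[OF legendre_P_recurrence[OF assms \<open>x \<in> _\<close>], of "\<lambda>u. u / (2 * real n + 1)"]
      by (auto simp: a_def b_def add_divide_distrib[of "u * legendre_P m k x" for u k] split: if_splits)
    then have "x * legendre_P m n x * legendre_P m l x / sqrt (1 - x\<^sup>2)
        = (a * legendre_P m (n + 1) x + b * legendre_P m (n - 1) x) * legendre_P m l x / sqrt (1 - x\<^sup>2)"
      by simp
    then show "a * h (n + 1) x + b * h (n - 1) x
        = x * legendre_P m n x * legendre_P m l x / sqrt (1 - x\<^sup>2)"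
      by (simp add: h_def algebra_simps add_divide_distrib)
  qed simp
  finally show ?thesis by (cases "n = 0") (simp_all add: a_def b_def)
qed

theorem mainTheorem2:
  fixes m n l :: nat
  assumes "m \<le> min l n"
  shows
    "(real n - real m + 1) / (2 * real n + 1) * legendre_g m (n + 1) l
       + (real m + real n) / (2 * real n + 1)
           * (if n = 0 then 0 else legendre_g m (n - 1) l)
     = (real l - real m + 1) / (2 * real l + 1) * legendre_g m n (l + 1)
       + (real m + real l) / (2 * real l + 1)
           * (if l = 0 then 0 else legendre_g m n (l - 1))"
proof -
  have "m \<le> n" "m \<le> l" using assms by auto
  then show ?thesis
    \<comment> \<open>Symmetry of the entries turns the right-hand side into the recurrence with
      \<open>n\<close> and \<open>l\<close> exchanged; the two integrals then differ only in the
      order of the factors.\<close>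
    unfolding legendre_g_commute[of m n "l + 1"] legendre_g_commute[of m n "l - 1"]
    by (simp only: legendre_g_recurrence mult.assoc mult.left_commute[of "legendre_P m n _"]
        mult.commute[of "legendre_P m n _" "legendre_P m l _"])
qed

end
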